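(* Let $n,d\ge1$ and let $\tilde{\mathcal H}_{n,2d}$ denote the vector space of real polynomials in $n$ variables of degree at most $2d$. Any polynomial $p\in\tilde{\mathcal H}_{n,2d}$ can be written as the difference of two dsos-convex polynomials in $\tilde{\mathcal H}_{n,2d}$.
   Context: A symmetric matrix $M=(m_{ij})$ is diagonally dominant (dd) if $m_{ii}\ge\sum_{j\ne i}|m_{ij}|$ for all $i$. A polynomial $q$ of degree (at most) $2k$ in variables $u=(u_1,\ldots,u_N)$ is dsos (diagonally-dominant-sum-of-squares) if $q(u)=\tilde z(u)^TQ\tilde z(u)$ for some diagonally dominant matrix $Q$, where $\tilde z(u)$ is the vector of all monomials in $u$ of degree up to $k$. A polynomial $p$ in $n$ variables $x$, with Hessian $H_p(x)$, is dsos-convex if $y^TH_p(x)y$ is dsos as a polynomial in the $2n$ variables $(x,y)$, $y=(y_1,\ldots,y_n)$. *)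

theory Defs
  imports Complex_Main "HOL-Library.Poly_Mapping"
begin

text \<open>A monomial maps each variable to its exponent, and a polynomial maps each monomial to its
  coefficient. Multiplication is the convolution product of \<^theory>\<open>HOL-Library.Poly_Mapping\<close>.
  The number of variables is the cardinality of the variable type \<open>'v\<close>.\<close>

type_synonym 'v monomial = "'v \<Rightarrow>\<^sub>0 nat"
type_synonym 'v real_poly = "'v monomial \<Rightarrow>\<^sub>0 real"

definition Const :: "real \<Rightarrow> 'v real_poly" where
  "Const c = Poly_Mapping.single 0 c"

definition Mon :: "'v monomial \<Rightarrow> 'v real_poly" where
  "Mon m = Poly_Mapping.single m 1"

definition Var :: "'v \<Rightarrow> 'v real_poly" where
  "Var i = Mon (Poly_Mapping.single i 1)"

definition monomial_degree :: "'v monomial \<Rightarrow> nat" where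
  "monomial_degree m = (\<Sum>i\<in>Poly_Mapping.keys m. Poly_Mapping.lookup m i)"

definition polys_upto :: "nat \<Rightarrow> 'v real_poly set" where
  "polys_upto e = {p. \<forall>m\<in>Poly_Mapping.keys p. monomial_degree m \<le> e}"

definition monomials_upto :: "nat \<Rightarrow> 'v monomial set" where
  "monomials_upto k = {m. monomial_degree m \<le> k}"

text \<open>Sums over \<^term>\<open>monomials_upto k\<close> are meaningful because this set is finite.\<close>

lemma finite_monomials_upto: "finite (monomials_upto k :: 'v::finite monomial set)"
proof -
  have "Poly_Mapping.lookup m i \<le> k" if "monomial_degree m \<le> k" for m :: "'v monomial" and i
  proof (cases "i \<in> Poly_Mapping.keys m")
    case True
    then have "Poly_Mapping.lookup m i \<le> monomial_degree m"
      unfolding monomial_degree_def by (intro member_le_sum) auto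
    with that show ?thesis by simp
  qed (simp add: in_keys_iff)
  then have "Poly_Mapping.lookup ` (monomials_upto k :: 'v monomial set)
      \<subseteq> {f. \<forall>i. (i \<in> UNIV \<longrightarrow> f i \<in> {..k}) \<and> (i \<notin> UNIV \<longrightarrow> f i = 0)}"
    by (auto simp: monomials_upto_def)
  moreover have "finite {f :: 'v \<Rightarrow> nat. \<forall>i. (i \<in> UNIV \<longrightarrow> f i \<in> {..k}) \<and> (i \<notin> UNIV \<longrightarrow> f i = 0)}"
    by (rule finite_set_of_finite_funs) auto
  ultimately have "finite (Poly_Mapping.lookup ` (monomials_upto k :: 'v monomial set))"
    by (rule finite_subset)
  then show ?thesis
    by (rule finite_imageD) (simp add: inj_on_def)
qed

text \<open>Only the entries indexed by \<open>I\<close> matter.\<close>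

definition diagonally_dominant :: "'i set \<Rightarrow> ('i \<Rightarrow> 'i \<Rightarrow> real) \<Rightarrow> bool" where
  "diagonally_dominant I M \<longleftrightarrow>
     (\<forall>i\<in>I. \<forall>j\<in>I. M i j = M j i) \<and>
     (\<forall>i\<in>I. M i i \<ge> (\<Sum>j\<in>I - {i}. \<bar>M i j\<bar>))"

text \<open>The parameter \<open>k\<close> is half the degree bound. The Gram matrix \<open>Q\<close> is indexed by the monomials
  themselves, so that the entries of the vector of monomials are the polynomials \<^term>\<open>Mon a\<close>.\<close>

definition dsos :: "nat \<Rightarrow> 'v::finite real_poly \<Rightarrow> bool" where
  "dsos k q \<longleftrightarrow> q \<in> polys_upto (2 * k) \<and>
     (\<exists>Q. diagonally_dominant (monomials_upto k) Q \<and>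
        q = (\<Sum>a\<in>monomials_upto k. \<Sum>b\<in>monomials_upto k. Mon a * Const (Q a b) * Mon b))"

text \<open>If the exponent of \<open>i\<close> in \<open>m\<close> is \<open>0\<close>, then the truncated difference in the exponent
  is harmless because the coefficient vanishes.\<close>

definition partial_deriv :: "'v \<Rightarrow> 'v real_poly \<Rightarrow> 'v real_poly" where
  "partial_deriv i p = (\<Sum>m\<in>Poly_Mapping.keys p.
     Poly_Mapping.single (m - Poly_Mapping.single i 1)
       (real (Poly_Mapping.lookup m i) * Poly_Mapping.lookup p m))"

definition hessian :: "'v real_poly \<Rightarrow> 'v \<Rightarrow> 'v \<Rightarrow> 'v real_poly" where
  "hessian p i j = partial_deriv i (partial_deriv j p)"

definition rename_monomial :: "('v \<Rightarrow> 'w) \<Rightarrow> 'v monomial \<Rightarrow> 'w monomial" where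
  "rename_monomial f m =
     (\<Sum>i\<in>Poly_Mapping.keys m. Poly_Mapping.single (f i) (Poly_Mapping.lookup m i))"

definition rename_poly :: "('v \<Rightarrow> 'w) \<Rightarrow> 'v real_poly \<Rightarrow> 'w real_poly" where
  "rename_poly f p =
     (\<Sum>m\<in>Poly_Mapping.keys p. Poly_Mapping.single (rename_monomial f m) (Poly_Mapping.lookup p m))"

text \<open>The polynomial \<open>y\<^sup>T H\<^sub>p(x) y\<close> in the variables \<open>(x, y)\<close>, where \<open>x\<^sub>i\<close> is \<^term>\<open>Inl i\<close> and
  \<open>y\<^sub>i\<close> is \<^term>\<open>Inr i\<close>.\<close>

definition hessian_form :: "'v::finite real_poly \<Rightarrow> ('v + 'v) real_poly" where
  "hessian_form p =
     (\<Sum>i\<in>UNIV. \<Sum>j\<in>UNIV. Var (Inr i) * rename_poly Inl (hessian p i j) * Var (Inr j))"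

text \<open>For \<open>p\<close> of degree at most \<open>2 * d\<close> with \<open>d \<ge> 1\<close>, the form \<^term>\<open>hessian_form p\<close> has degree
  at most \<open>2 * d\<close> in \<open>(x, y)\<close>, so \<open>d\<close> is also the degree bound for its Gram monomials.\<close>

definition dsos_convex :: "nat \<Rightarrow> 'v::finite real_poly \<Rightarrow> bool" where
  "dsos_convex d p \<longleftrightarrow> dsos d (hessian_form p)"

end

theory Submission
  imports Defs
begin

text \<open>
  Call a polynomial \<open>q\<close> in \<open>(x, y)\<close> bounded if some polynomial \<open>g\<close> of degree at most \<open>2d\<close> in \<open>x\<close> has
  both \<open>H g + q\<close> and \<open>H g - q\<close> dsos, where \<open>H g = y\<^sup>T H\<^sub>g(x) y\<close>. If \<open>H p\<close> is bounded, through \<open>g\<close>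
  say, then \<open>p = (g + p)/2 - (g - p)/2\<close> is a difference of the required kind. So the task is to show
  that every Hessian form is bounded.

  The dsos polynomials form a convex cone and \<open>H\<close> is linear, hence the bounded polynomials form a
  linear subspace. The square of a binomial \<open>m \<plusminus> m'\<close> of monomials is dsos; therefore, if \<open>m\<^sup>2\<close> and
  \<open>m'\<^sup>2\<close> are bounded, so is the product \<open>m m'\<close> (\<open>hessian_bounded_mult\<close>). A Hessian form is a
  combination of terms \<open>y\<^sub>i y\<^sub>j x\<^sup>c\<close>, and for \<open>c\<close> of degree at most \<open>2d - 2\<close> such a term is a product of some
  \<open>y\<^sub>i x\<^sup>b\<close> and \<open>y\<^sub>j x\<^sup>b'\<close> with \<open>b, b'\<close> of degree at most \<open>d - 1\<close>. What remains is to bound all the squares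
  \<open>(y\<^sub>i x\<^sup>b)\<^sup>2\<close> with \<open>b\<close> of degree below \<open>d\<close> (\<open>square_bounded_all\<close>).

  This goes by induction on the number of variables that occur in \<open>x\<^sup>a = x\<^sub>i x\<^sup>b\<close>. The form
  \<open>H (x\<^sup>2\<^sup>a)\<close> contains each \<open>(y\<^sub>k x\<^sup>a / x\<^sub>k)\<^sup>2\<close> with a positive coefficient, so these squares are bounded
  as soon as the mixed terms of \<open>H (x\<^sup>2\<^sup>a)\<close> are (\<open>square_bounded_even\<close>). One variable gives no mixed
  terms. For three or more variables, a mixed term \<open>y\<^sub>k y\<^sub>l x\<^sup>2\<^sup>a / (x\<^sub>k x\<^sub>l)\<close> can be factored by writing
  \<open>2a = p + q\<close>, with \<open>p\<close> and \<open>q\<close> of the degree of \<open>a\<close> and each missing one of the variables of \<open>a\<close>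
  (\<open>split_even_monomial\<close>); the induction hypothesis bounds the squares of both factors.

  For two variables \<open>x\<^sub>i, x\<^sub>j\<close> such a factorization is possible only if their exponents agree.
  There the polynomial \<open>(x\<^sub>i\<^sup>2 + x\<^sub>j\<^sup>2)\<^sup>k\<close>
  helps: its Hessian form is
  \<open>2k (x\<^sub>i\<^sup>2 + x\<^sub>j\<^sup>2)\<^sup>k\<^sup>-\<^sup>1 (y\<^sub>i\<^sup>2 + y\<^sub>j\<^sup>2) + 4k(k-1) (x\<^sub>i\<^sup>2 + x\<^sub>j\<^sup>2)\<^sup>k\<^sup>-\<^sup>2 (x\<^sub>i y\<^sub>i + x\<^sub>j y\<^sub>j)\<^sup>2\<close>.
  When the powers are multiplied out, the first summand has all the squares in question with
  positive coefficients, and the second one is a sum of squares of binomials (\<open>square_bounded_pair\<close>).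
\<close>

section \<open>Polynomials and Hessian forms\<close>

abbreviation expo :: "'v monomial \<Rightarrow> 'v \<Rightarrow> nat" where
  "expo \<equiv> Poly_Mapping.lookup"

abbreviation unit_expo :: "'v \<Rightarrow> 'v monomial" where
  "unit_expo i \<equiv> Poly_Mapping.single i 1"

lemma Const_0 [simp]: "Const 0 = 0"
  by (simp add: Const_def)

lemma Const_1 [simp]: "Const 1 = 1"
  by (simp add: Const_def)

lemma Const_add: "Const (a + b) = Const a + Const b"
  by (simp add: Const_def single_add)

lemma Const_uminus: "Const (- a) = - Const a"
  by (simp add: Const_def single_uminus)

lemma Const_mult: "Const (a * b) = Const a * Const b"
  by (simp add: Const_def mult_single)

lemma Mon_add: "Mon (a + b) = Mon a * Mon b"
  by (simp add: Mon_def mult_single)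

lemma Const_times_single: "Const c * Poly_Mapping.single m a = Poly_Mapping.single m (c * a)"
  by (simp add: Const_def mult_single)

lemma poly_as_sum: "p = (\<Sum>m\<in>Poly_Mapping.keys p. Poly_Mapping.single m (Poly_Mapping.lookup p m))"
proof (rule poly_mapping_eqI)
  fix k
  show "Poly_Mapping.lookup p k = Poly_Mapping.lookup
          (\<Sum>m\<in>Poly_Mapping.keys p. Poly_Mapping.single m (Poly_Mapping.lookup p m)) k"
    by (cases "k \<in> Poly_Mapping.keys p")
      (auto simp: lookup_sum lookup_single when_def in_keys_iff)
qed

lemma real_poly_induct [case_names single add]:
  assumes single: "\<And>m a. P (Poly_Mapping.single m a)"
    and add: "\<And>p q. P p \<Longrightarrow> P q \<Longrightarrow> P (p + q)"
  shows "P (p :: 'v real_poly)"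
proof -
  have "P (\<Sum>m\<in>S. Poly_Mapping.single m (f m))" if "finite S" for S f
    using that
  proof induction
    case empty
    show ?case using single[of 0 0] by simp
  qed (simp add: assms)
  then show ?thesis
    using poly_as_sum[of p] by (metis finite_keys)
qed

lemma monomial_degree_eq_sum:
  fixes m :: "'v::finite monomial"
  shows "monomial_degree m = (\<Sum>i\<in>UNIV. expo m i)"
  unfolding monomial_degree_def by (rule sum.mono_neutral_left) (auto simp: in_keys_iff)

lemma monomial_degree_add:
  "monomial_degree (a + b) = monomial_degree a + monomial_degree b"
  unfolding monomial_degree_def by (rule setsum_keys_plus_distrib) auto

lemma monomial_degree_single [simp]: "monomial_degree (Poly_Mapping.single i n) = n"
  by (simp add: monomial_degree_def)

lemma polys_upto_0 [simp]: "0 \<in> polys_upto e"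
  by (simp add: polys_upto_def)

lemma polys_upto_add: "p \<in> polys_upto e \<Longrightarrow> q \<in> polys_upto e \<Longrightarrow> p + q \<in> polys_upto e"
  using keys_add[of p q] unfolding polys_upto_def by blast

lemma polys_upto_sum: "(\<And>x. x \<in> S \<Longrightarrow> f x \<in> polys_upto e) \<Longrightarrow> sum f S \<in> polys_upto e"
  by (induction S rule: infinite_finite_induct) (auto intro: polys_upto_add)

lemma polys_upto_single: "monomial_degree m \<le> e \<Longrightarrow> Poly_Mapping.single m a \<in> polys_upto e"
  by (simp add: polys_upto_def)

lemma polys_upto_scale:
  assumes "p \<in> polys_upto e"
  shows "Const c * p \<in> polys_upto e"
proof -
  have "Const c * p = (\<Sum>m\<in>Poly_Mapping.keys p. Poly_Mapping.single m (c * Poly_Mapping.lookup p m))"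
    by (subst poly_as_sum) (simp add: sum_distrib_left Const_times_single)
  also have "\<dots> \<in> polys_upto e"
    using assms by (intro polys_upto_sum polys_upto_single) (simp add: polys_upto_def)
  finally show ?thesis .
qed

lemma partial_deriv_add: "partial_deriv i (p + q) = partial_deriv i p + partial_deriv i q"
  unfolding partial_deriv_def
  by (rule setsum_keys_plus_distrib) (simp_all add: distrib_left single_add)

lemma partial_deriv_single:
  "partial_deriv i (Poly_Mapping.single m a) =
     Poly_Mapping.single (m - unit_expo i) (real (expo m i) * a)"
  by (simp add: partial_deriv_def)

lemma rename_poly_add: "rename_poly f (p + q) = rename_poly f p + rename_poly f q"
  unfolding rename_poly_def
  by (rule setsum_keys_plus_distrib) (simp_all add: single_add)

lemma rename_poly_single:
  "rename_poly f (Poly_Mapping.single m a) = Poly_Mapping.single (rename_monomial f m) a"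
  by (simp add: rename_poly_def)

lemma rename_monomial_add: "rename_monomial f (a + b) = rename_monomial f a + rename_monomial f b"
  unfolding rename_monomial_def
  by (rule setsum_keys_plus_distrib) (simp_all add: single_add)

lemma monomial_degree_rename [simp]: "monomial_degree (rename_monomial f m) = monomial_degree m"
proof -
  have "monomial_degree (\<Sum>i\<in>S. Poly_Mapping.single (f i) (g i)) = sum g S" if "finite S" for S g
    using that by induction (simp_all add: monomial_degree_add monomial_degree_def[of 0])
  then show ?thesis
    by (simp add: rename_monomial_def monomial_degree_def[of m])
qed

lemma hessian_form_add: "hessian_form (p + q) = hessian_form p + hessian_form q"
  by (simp add: hessian_form_def hessian_def partial_deriv_add rename_poly_add
      algebra_simps sum.distrib)

lemma hessian_form_0 [simp]: "hessian_form 0 = 0"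
  using hessian_form_add[of 0 0] by simp

lemma hessian_form_sum: "hessian_form (sum f S) = (\<Sum>x\<in>S. hessian_form (f x))"
  by (induction S rule: infinite_finite_induct) (simp_all add: hessian_form_add)

text \<open>The coefficient of the second partial derivative of a monomial. Differentiating first by
  \<open>j\<close> and then by \<open>i\<close> gives \<open>m\<^sub>i m\<^sub>j\<close> for \<open>i \<noteq> j\<close> and \<open>m\<^sub>i (m\<^sub>i - 1)\<close> for \<open>i = j\<close> with one formula.\<close>

definition hessian_coeff :: "'v monomial \<Rightarrow> 'v \<Rightarrow> 'v \<Rightarrow> real" where
  "hessian_coeff m i j = real (expo m j) * real (expo (m - unit_expo j) i)"

text \<open>The monomial \<open>y\<^sub>i x\<^sup>b\<close>. These are the only Gram monomials needed for Hessian forms.\<close>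

definition y_monomial :: "'v \<Rightarrow> 'v monomial \<Rightarrow> ('v + 'v) monomial" where
  "y_monomial i b = unit_expo (Inr i) + rename_monomial Inl b"

lemma monomial_degree_y_monomial [simp]: "monomial_degree (y_monomial i b) = Suc (monomial_degree b)"
  by (simp add: y_monomial_def monomial_degree_add)

text \<open>The whole \<open>x\<close>-part of the term \<open>y\<^sub>i y\<^sub>j x\<^sup>c\<close> is attached to \<open>y\<^sub>i\<close>. This is only a normal form:
  \<open>y_monomial_mult\<close> moves any part of the exponent over to \<open>y\<^sub>j\<close>, and choosing this part well is what
  the later proofs are about.\<close>

lemma hessian_form_single:
  "hessian_form (Poly_Mapping.single m a) =
     (\<Sum>i\<in>UNIV. \<Sum>j\<in>UNIV. Const (a * hessian_coeff m i j) *
        (Mon (y_monomial i (m - unit_expo j - unit_expo i)) * Mon (y_monomial j 0)))"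
  unfolding hessian_form_def hessian_def y_monomial_def hessian_coeff_def
  by (intro sum.cong refl)
    (simp add: partial_deriv_single rename_poly_single Var_def Mon_def Const_def mult_single
      mult_ac add_ac rename_monomial_def[of _ 0])

lemma hessian_form_scale: "hessian_form (Const c * p) = Const c * hessian_form p"
proof (induction p rule: real_poly_induct)
  case (single m a)
  show ?case
    by (simp only: Const_times_single hessian_form_single)
      (simp only: Const_mult sum_distrib_left mult.assoc)
qed (simp add: distrib_left hessian_form_add)

lemma y_monomial_mult:
  "Mon (y_monomial i (b + b')) * Mon (y_monomial j 0) = Mon (y_monomial i b) * Mon (y_monomial j b')"
  by (simp add: y_monomial_def Mon_add rename_monomial_add rename_monomial_def[of _ 0] Mon_def[of 0])

section \<open>The cone of dsos polynomials\<close>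

lemma polys_upto_gram:
  "(\<Sum>a\<in>monomials_upto k. \<Sum>b\<in>monomials_upto k. Mon a * Const (Q a b) * Mon b) \<in> polys_upto (2 * k)"
  by (intro polys_upto_sum)
    (auto simp: Mon_def Const_def mult_single monomials_upto_def monomial_degree_add
      intro!: polys_upto_single)

lemma dsosI:
  assumes "diagonally_dominant (monomials_upto k) Q"
    and "q = (\<Sum>a\<in>monomials_upto k. \<Sum>b\<in>monomials_upto k. Mon a * Const (Q a b) * Mon b)"
  shows "dsos k q"
  unfolding dsos_def using assms polys_upto_gram by blast

lemma dsos_0: "dsos k 0"
  by (rule dsosI[where Q = "\<lambda>_ _. 0"]) (simp_all add: diagonally_dominant_def)

lemma dsos_add:
  assumes "dsos k p" "dsos k q"
  shows "dsos k (p + q)"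
proof -
  obtain P Q where P: "diagonally_dominant (monomials_upto k) P"
      "p = (\<Sum>a\<in>monomials_upto k. \<Sum>b\<in>monomials_upto k. Mon a * Const (P a b) * Mon b)"
    and Q: "diagonally_dominant (monomials_upto k) Q"
      "q = (\<Sum>a\<in>monomials_upto k. \<Sum>b\<in>monomials_upto k. Mon a * Const (Q a b) * Mon b)"
    using assms unfolding dsos_def by blast
  have "(\<Sum>b\<in>monomials_upto k - {a}. \<bar>P a b + Q a b\<bar>) \<le> P a a + Q a a"
    if "a \<in> monomials_upto k" for a
  proof -
    have "(\<Sum>b\<in>monomials_upto k - {a}. \<bar>P a b + Q a b\<bar>)
        \<le> (\<Sum>b\<in>monomials_upto k - {a}. \<bar>P a b\<bar> + \<bar>Q a b\<bar>)"
      by (intro sum_mono) simp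
    also have "\<dots> \<le> P a a + Q a a"
      unfolding sum.distrib using that P(1) Q(1)
      unfolding diagonally_dominant_def by (intro add_mono) blast+
    finally show ?thesis .
  qed
  with P(1) Q(1) have "diagonally_dominant (monomials_upto k) (\<lambda>a b. P a b + Q a b)"
    by (auto simp: diagonally_dominant_def)
  then show ?thesis
    by (rule dsosI) (simp add: P(2) Q(2) Const_add algebra_simps sum.distrib)
qed

lemma dsos_sum: "(\<And>x. x \<in> S \<Longrightarrow> dsos k (f x)) \<Longrightarrow> dsos k (sum f S)"
  by (induction S rule: infinite_finite_induct) (auto intro: dsos_add dsos_0)

lemma dsos_scale:
  assumes "dsos k q" "c \<ge> 0"
  shows "dsos k (Const c * q)"
proof -
  obtain Q where Q: "diagonally_dominant (monomials_upto k) Q"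
      "q = (\<Sum>a\<in>monomials_upto k. \<Sum>b\<in>monomials_upto k. Mon a * Const (Q a b) * Mon b)"
    using assms unfolding dsos_def by blast
  have "diagonally_dominant (monomials_upto k) (\<lambda>a b. c * Q a b)"
    using Q(1) \<open>c \<ge> 0\<close>
    by (simp add: diagonally_dominant_def abs_mult sum_distrib_left[symmetric] mult_left_mono)
  then show ?thesis
    by (rule dsosI) (simp add: Q(2) Const_mult sum_distrib_left mult_ac)
qed

lemma dsos_square:
  fixes a :: "'v::finite monomial"
  assumes "a \<in> monomials_upto k"
  shows "dsos k (Mon a * Mon a)"
proof (rule dsosI)
  show "diagonally_dominant (monomials_upto k) (\<lambda>x y. if x = a \<and> y = a then 1 else 0)"
    by (auto simp: diagonally_dominant_def)
  have "(\<Sum>y\<in>monomials_upto k. Mon x * Const (if x = a \<and> y = a then 1 else 0) * Mon y)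
      = (if x = a then Mon a * Mon a else 0)" for x
    using assms
    by (simp add: finite_monomials_upto if_distrib[of Const] if_distrib[of "\<lambda>z. _ * z"]
        if_distrib[of "\<lambda>z. z * _"] cong: if_cong)
  then show "Mon a * Mon a = (\<Sum>x\<in>monomials_upto k. \<Sum>y\<in>monomials_upto k.
      Mon x * Const (if x = a \<and> y = a then 1 else 0) * Mon y)"
    using assms by (simp add: finite_monomials_upto)
qed

text \<open>The Gram matrix is the rank-one matrix of the coefficient vector of the binomial. Because the two
  coefficients have the same absolute value, both nonzero rows are diagonally dominant with equality.
  A square of a sum of three monomials would fail this test.
  When the two monomials agree, the square is just a nonnegative multiple of \<open>m\<^sup>2\<close>.\<close>

lemma dsos_binomial_square:
  fixes a b :: "'v::finite monomial"
  assumes "a \<in> monomials_upto k" "b \<in> monomials_upto k" "s \<in> {-1, 1 :: real}"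
  shows "dsos k ((Mon a + Const s * Mon b) * (Mon a + Const s * Mon b))"
proof (cases "a = b")
  case True
  have "(Mon a + Const s * Mon b) * (Mon a + Const s * Mon b)
      = Const ((1 + s) * (1 + s)) * (Mon a * Mon a)"
    by (simp only: True Const_add Const_mult Const_1 mult_1 algebra_simps)
  then show ?thesis using dsos_scale[OF dsos_square[OF assms(1)]] by simp
next
  case False
  define c where "c = (\<lambda>x. if x = a then 1 else if x = b then s else 0)"
  have vec: "(\<Sum>x\<in>monomials_upto k. Mon x * Const (c x)) = Mon a + Const s * Mon b"
  proof -
    have "(\<Sum>x\<in>monomials_upto k. Mon x * Const (c x)) = (\<Sum>x\<in>{a, b}. Mon x * Const (c x))"
      using assms finite_monomials_upto
      by (intro sum.mono_neutral_right) (auto simp: c_def)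
    then show ?thesis using False by (simp add: c_def mult_ac)
  qed
  have "(\<Sum>y\<in>monomials_upto k - {x}. \<bar>c x * c y\<bar>) \<le> c x * c x" for x
  proof -
    have "(\<Sum>y\<in>monomials_upto k - {x}. \<bar>c x * c y\<bar>) = (\<Sum>y\<in>{a, b} - {x}. \<bar>c x * c y\<bar>)"
      using assms finite_monomials_upto
      by (intro sum.mono_neutral_right) (auto simp: c_def)
    also have "\<dots> \<le> c x * c x"
    proof -
      consider "x = a" | "x = b" | "x \<noteq> a" "x \<noteq> b" by blast
      then show ?thesis
      proof cases
        case 1
        have "{a, b} - {a} = {b}" using False by blast
        with 1 assms(3) False show ?thesis by (simp add: c_def) fastforce
      next
        case 2
        have "{a, b} - {b} = {a}" using False by blast
        with 2 assms(3) False show ?thesis by (simp add: c_def) fastforce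
      next
        case 3
        then show ?thesis by (simp add: c_def)
      qed
    qed
    finally show ?thesis .
  qed
  then have "diagonally_dominant (monomials_upto k) (\<lambda>x y. c x * c y)"
    by (simp add: diagonally_dominant_def mult_ac)
  then show ?thesis
    unfolding vec[symmetric] by (rule dsosI) (simp add: sum_product Const_mult mult_ac)
qed

section \<open>Forms controlled by dsos-convex polynomials\<close>

text \<open>Boundedness by a Hessian form, from both sides. The polynomial \<open>g\<close> is then dsos-convex, as
  \<open>2 H g\<close> is the sum of the two dsos polynomials.\<close>

definition hessian_bounded :: "nat \<Rightarrow> ('v::finite + 'v) real_poly \<Rightarrow> bool" where
  "hessian_bounded d q \<longleftrightarrow>
     (\<exists>g\<in>polys_upto (2 * d). dsos d (hessian_form g + q) \<and> dsos d (hessian_form g - q))"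

lemma hessian_bounded_0: "hessian_bounded d 0"
  unfolding hessian_bounded_def by (rule bexI[of _ 0]) (simp_all add: dsos_0)

lemma hessian_bounded_add:
  assumes "hessian_bounded d p" "hessian_bounded d q"
  shows "hessian_bounded d (p + q)"
proof -
  obtain g h where "g \<in> polys_upto (2 * d)" "h \<in> polys_upto (2 * d)"
    and g: "dsos d (hessian_form g + p)" "dsos d (hessian_form g - p)"
    and h: "dsos d (hessian_form h + q)" "dsos d (hessian_form h - q)"
    using assms unfolding hessian_bounded_def by blast
  then show ?thesis
    unfolding hessian_bounded_def
    using dsos_add[OF g(1) h(1)] dsos_add[OF g(2) h(2)]
    by (intro bexI[of _ "g + h"] polys_upto_add) (simp_all add: hessian_form_add algebra_simps)
qed

lemma hessian_bounded_sum:
  "(\<And>x. x \<in> S \<Longrightarrow> hessian_bounded d (f x)) \<Longrightarrow> hessian_bounded d (sum f S)"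
  by (induction S rule: infinite_finite_induct) (auto intro: hessian_bounded_add hessian_bounded_0)

lemma hessian_bounded_uminus: "hessian_bounded d q \<Longrightarrow> hessian_bounded d (- q)"
  unfolding hessian_bounded_def by auto

lemma hessian_bounded_scale:
  assumes "hessian_bounded d q"
  shows "hessian_bounded d (Const c * q)"
proof -
  have nonneg: "hessian_bounded d (Const c * q)" if "c \<ge> 0" for c
  proof -
    obtain g where "g \<in> polys_upto (2 * d)"
      and g: "dsos d (hessian_form g + q)" "dsos d (hessian_form g - q)"
      using assms unfolding hessian_bounded_def by blast
    then show ?thesis
      unfolding hessian_bounded_def using dsos_scale[OF g(1) that] dsos_scale[OF g(2) that]
      by (intro bexI[of _ "Const c * g"] polys_upto_scale)
        (simp_all add: hessian_form_scale distrib_left right_diff_distrib)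
  qed
  show ?thesis
  proof (cases "c \<ge> 0")
    case False
    then have "hessian_bounded d (- (Const (- c) * q))"
      by (intro hessian_bounded_uminus nonneg) simp
    then show ?thesis by (simp add: Const_uminus)
  qed (rule nonneg)
qed

text \<open>If \<open>H g - m\<^sup>2\<close> and \<open>H h - m'\<^sup>2\<close> are dsos, then so is
  \<open>(H g - m\<^sup>2) + (H h - m'\<^sup>2) + (m \<plusminus> m')\<^sup>2 = H (g + h) \<plusminus> 2 m m'\<close>.\<close>

lemma hessian_bounded_mult:
  fixes a b :: "('v::finite + 'v) monomial"
  assumes "a \<in> monomials_upto d" "b \<in> monomials_upto d"
    and "hessian_bounded d (Mon a * Mon a)" "hessian_bounded d (Mon b * Mon b)"
  shows "hessian_bounded d (Mon a * Mon b)"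
proof -
  obtain g h where gh: "g \<in> polys_upto (2 * d)" "h \<in> polys_upto (2 * d)"
    and g: "dsos d (hessian_form g - Mon a * Mon a)"
    and h: "dsos d (hessian_form h - Mon b * Mon b)"
    using assms(3,4) unfolding hessian_bounded_def by blast
  have "dsos d (hessian_form (g + h) + Const (2 * s) * (Mon a * Mon b))" if s: "s \<in> {-1, 1}" for s
  proof -
    have "Const s * Const s = (1 :: ('v + 'v) real_poly)"
      using s by (auto simp: Const_mult[symmetric])
    then have sq: "(Mon a + Const s * Mon b) * (Mon a + Const s * Mon b)
        = Mon a * Mon a + Const (2 * s) * (Mon a * Mon b) + Mon b * Mon b"
      by (simp add: Const_mult Const_add[of 1 1, simplified] algebra_simps)
        (simp add: mult.assoc[symmetric])
    have "dsos d ((hessian_form g - Mon a * Mon a) + (hessian_form h - Mon b * Mon b)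
        + (Mon a + Const s * Mon b) * (Mon a + Const s * Mon b))"
      using assms(1,2) s by (intro dsos_add g h dsos_binomial_square)
    then show ?thesis
      unfolding sq by (simp add: hessian_form_add algebra_simps)
  qed
  from this[of 1] this[of "-1"] have "hessian_bounded d (Const 2 * (Mon a * Mon b))"
    unfolding hessian_bounded_def using polys_upto_add[OF gh]
    by (intro bexI[of _ "g + h"]) (simp_all add: Const_uminus)
  then have "hessian_bounded d (Const (1 / 2) * (Const 2 * (Mon a * Mon b)))"
    by (rule hessian_bounded_scale)
  then show ?thesis by (simp add: mult.assoc[symmetric] Const_mult[symmetric])
qed

text \<open>The error term \<open>r\<close> is only bounded, so a bound \<open>h\<close> for it is added to \<open>g\<close>, so that
  \<open>H (g + h) - q = t + (H h + r)\<close> becomes dsos.\<close>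

lemma hessian_bounded_summand:
  assumes "g \<in> polys_upto (2 * d)" "hessian_form g = q + t + r"
    and "dsos d q" "dsos d t" "hessian_bounded d r"
  shows "hessian_bounded d q"
proof -
  obtain h where h: "h \<in> polys_upto (2 * d)" "dsos d (hessian_form h + r)"
    using assms(5) unfolding hessian_bounded_def by blast
  have 1: "dsos d (t + (hessian_form h + r))"
    by (intro dsos_add assms h)
  have "dsos d (q + q + (t + (hessian_form h + r)))"
    by (intro dsos_add assms h)
  with 1 show ?thesis
    unfolding hessian_bounded_def using polys_upto_add[OF assms(1) h(1)]
    by (intro bexI[of _ "g + h"]) (simp_all add: hessian_form_add assms(2) algebra_simps)
qed

text \<open>The bound on the degree makes \<open>y\<^sub>i x\<^sup>b\<close> an admissible Gram monomial, so that products of two such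
  monomials can be bounded from their squares.\<close>

definition square_bounded :: "nat \<Rightarrow> 'v::finite \<Rightarrow> 'v monomial \<Rightarrow> bool" where
  "square_bounded d i b \<longleftrightarrow> monomial_degree b < d \<and>
     hessian_bounded d (Mon (y_monomial i b) * Mon (y_monomial i b))"

lemma y_monomial_upto: "monomial_degree b < d \<Longrightarrow> y_monomial i b \<in> monomials_upto d"
  by (simp add: monomials_upto_def)

lemma square_boundedI:
  assumes "monomial_degree b < d" "c > 0"
    and "hessian_bounded d (Const c * (Mon (y_monomial i b) * Mon (y_monomial i b)))"
  shows "square_bounded d i b"
proof -
  let ?q = "Mon (y_monomial i b) * Mon (y_monomial i b)"
  have "Const (1 / c) * (Const c * ?q) = ?q"
    using assms(2) by (simp only: mult.assoc[symmetric] Const_mult[symmetric]) simp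
  then show ?thesis
    using hessian_bounded_scale[OF assms(3), of "1 / c"] assms(1) by (simp add: square_bounded_def)
qed

lemma hessian_bounded_mixed:
  assumes "square_bounded d i b" "square_bounded d j b'"
  shows "hessian_bounded d (Mon (y_monomial i (b + b')) * Mon (y_monomial j 0))"
  using assms unfolding y_monomial_mult square_bounded_def
  by (simp add: hessian_bounded_mult y_monomial_upto)

section \<open>Squares coming from even monomials\<close>

lemma minus_unit_expo_add: "expo m i > 0 \<Longrightarrow> m - unit_expo i + unit_expo i = m"
  by (rule poly_mapping_eqI) (auto simp: lookup_add lookup_minus lookup_single when_def)

text \<open>The diagonal terms of \<open>H (x\<^sup>2\<^sup>a)\<close> are positive multiples of the squares \<open>(y\<^sub>k x\<^sup>a / x\<^sub>k)\<^sup>2\<close>, so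
  each one is a dsos summand in the sense of \<open>hessian_bounded_summand\<close>; the mixed terms, which are bounded by
  the splitting hypothesis, form the remainder.\<close>

lemma square_bounded_even:
  fixes a :: "'v::finite monomial"
  assumes deg: "monomial_degree a \<le> d" and pos: "expo a i > 0"
    and split: "\<And>i j. i \<noteq> j \<Longrightarrow> expo a i > 0 \<Longrightarrow> expo a j > 0 \<Longrightarrow>
      \<exists>b b'. a + a = b + b' + unit_expo i + unit_expo j \<and> square_bounded d i b \<and> square_bounded d j b'"
  shows "square_bounded d i (a - unit_expo i)"
proof -
  have degm: "monomial_degree (a - unit_expo i) < d" if "expo a i > 0" for i
    using arg_cong[OF minus_unit_expo_add[OF that], of monomial_degree] deg
    by (simp add: monomial_degree_add)
  define T where "T = (\<lambda>i j. Const (hessian_coeff (a + a) i j) *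
        (Mon (y_monomial i (a + a - unit_expo j - unit_expo i)) * Mon (y_monomial j 0)))"
  have diag: "T i i = Const (hessian_coeff (a + a) i i) *
      (Mon (y_monomial i (a - unit_expo i)) * Mon (y_monomial i (a - unit_expo i)))"
    if "expo a i > 0" for i
  proof -
    have "a + a - unit_expo i - unit_expo i = (a - unit_expo i) + (a - unit_expo i)"
      using that by (intro poly_mapping_eqI) (auto simp: lookup_add lookup_minus lookup_single when_def)
    then show ?thesis by (simp add: T_def y_monomial_mult)
  qed
  have coeff0: "hessian_coeff (a + a) i j = 0" if "expo a i = 0 \<or> expo a j = 0" for i j
    using that by (auto simp: hessian_coeff_def lookup_add lookup_minus)
  have dsos: "dsos d (T i i)" for i
  proof (cases "expo a i = 0")
    case True
    then show ?thesis by (simp add: T_def coeff0 dsos_0)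
  next
    case False
    then have pos: "expo a i > 0" by simp
    show ?thesis
      unfolding diag[OF pos]
      by (intro dsos_scale dsos_square y_monomial_upto degm[OF pos]) (simp add: hessian_coeff_def)
  qed
  have mixed: "hessian_bounded d (T i j)" if ne: "i \<noteq> j" for i j
  proof (cases "expo a i = 0 \<or> expo a j = 0")
    case True
    then show ?thesis by (simp add: T_def coeff0 hessian_bounded_0)
  next
    case False
    then obtain b b' where b: "a + a = b + b' + unit_expo i + unit_expo j"
        "square_bounded d i b" "square_bounded d j b'"
      using split[OF ne] by blast
    have "a + a - unit_expo j - unit_expo i = b + b'"
      unfolding b(1) by simp
    then show ?thesis
      unfolding T_def using b(2,3) by (simp only: hessian_bounded_scale hessian_bounded_mixed)
  qed
  have "hessian_form (Poly_Mapping.single (a + a) 1) = (\<Sum>k\<in>UNIV. \<Sum>l\<in>UNIV. T k l)"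
    by (simp add: hessian_form_single T_def)
  also have "\<dots> = (\<Sum>k\<in>UNIV. T k k + (\<Sum>l\<in>UNIV - {k}. T k l))"
    by (intro sum.cong refl sum.remove) auto
  also have "\<dots> = (\<Sum>k\<in>UNIV. T k k) + (\<Sum>k\<in>UNIV. \<Sum>l\<in>UNIV - {k}. T k l)"
    by (rule sum.distrib)
  also have "(\<Sum>k\<in>UNIV. T k k) = T i i + (\<Sum>k\<in>UNIV - {i}. T k k)"
    by (rule sum.remove) auto
  finally have "hessian_form (Poly_Mapping.single (a + a) 1)
      = T i i + (\<Sum>k\<in>UNIV - {i}. T k k) + (\<Sum>k\<in>UNIV. \<Sum>l\<in>UNIV - {k}. T k l)" .
  moreover have "Poly_Mapping.single (a + a) 1 \<in> polys_upto (2 * d)"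
    using deg by (simp add: polys_upto_single monomial_degree_add)
  moreover have "hessian_bounded d (\<Sum>k\<in>UNIV. \<Sum>l\<in>UNIV - {k}. T k l)"
    by (intro hessian_bounded_sum mixed) blast
  ultimately have "hessian_bounded d (T i i)"
    using dsos by (blast intro: hessian_bounded_summand dsos_sum)
  then show ?thesis
    unfolding diag[OF pos]
    by (rule square_boundedI[OF degm[OF pos], rotated])
      (use pos in \<open>simp add: hessian_coeff_def lookup_add lookup_minus\<close>)
qed

section \<open>Splitting monomials\<close>

lemma monomial_between:
  fixes l m :: "'v::finite monomial"
  assumes "\<And>x. expo l x \<le> expo m x" and "monomial_degree l \<le> r" "r \<le> monomial_degree m"
  obtains n where "\<And>x. expo l x \<le> expo n x" "\<And>x. expo n x \<le> expo m x" "monomial_degree n = r"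
proof -
  have "\<exists>n. (\<forall>x. expo l x \<le> expo n x \<and> expo n x \<le> expo m x) \<and> monomial_degree n = r"
    using assms(2,3)
  proof (induction r rule: dec_induct)
    case base
    then show ?case using assms(1) by auto
  next
    case (step r)
    then obtain n where n: "\<And>x. expo l x \<le> expo n x" "\<And>x. expo n x \<le> expo m x"
        "monomial_degree n = r"
      by auto
    have "\<exists>x. expo n x < expo m x"
    proof (rule ccontr)
      assume "\<not> ?thesis"
      then have "monomial_degree m \<le> monomial_degree n"
        by (auto simp: monomial_degree_eq_sum not_less intro: sum_mono)
      then show False using step.prems n(3) by simp
    qed
    then obtain x where "expo n x < expo m x" ..
    with n show ?case
      by (intro exI[of _ "n + unit_expo x"])
        (auto simp: lookup_add lookup_single when_def monomial_degree_add le_SucI)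
  qed
  then show ?thesis using that by blast
qed

lemma sum_expo_le_degree:
  fixes a :: "'v::finite monomial"
  shows "(\<Sum>x\<in>S. expo a x) \<le> monomial_degree a"
  unfolding monomial_degree_eq_sum by (rule sum_mono2) auto

text \<open>If neither exponent exceeds half the degree \<open>k\<close>, then \<open>p\<close> can take all of \<open>2 a\<^sub>i\<close> and leave all
  of \<open>2 a\<^sub>j\<close> to \<open>q\<close>. If, say, \<open>2 a\<^sub>i > k\<close>, then \<open>p\<close> and \<open>q\<close>, being of degree \<open>k\<close>, must both contain \<open>i\<close>; but then the other
  exponents are small, and \<open>p\<close> can take all of \<open>2 a\<^sub>l\<close> for a third variable \<open>l\<close> in place of \<open>i\<close>.\<close>

lemma split_even_monomial:
  fixes a :: "'v::finite monomial"
  assumes ij: "i \<noteq> j" "expo a i > 0" "expo a j > 0" and card: "card (Poly_Mapping.keys a) \<ge> 3"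
  obtains p q where "p + q = a + a" "monomial_degree p = monomial_degree a"
    "monomial_degree q = monomial_degree a" "expo p i > 0" "expo q j > 0"
    "Poly_Mapping.keys p \<subset> Poly_Mapping.keys a" "Poly_Mapping.keys q \<subset> Poly_Mapping.keys a"
proof -
  let ?k = "monomial_degree a"
  define splits where "splits = (\<lambda>i j p q. p + q = a + a \<and> monomial_degree p = ?k \<and>
    monomial_degree q = ?k \<and> expo p i > 0 \<and> expo q j > 0 \<and>
    Poly_Mapping.keys p \<subset> Poly_Mapping.keys a \<and> Poly_Mapping.keys q \<subset> Poly_Mapping.keys a)"
  have main: "\<exists>p q. splits i j p q"
    if ij: "i \<noteq> j" "expo a i > 0" "expo a j > 0" and j: "2 * expo a j \<le> ?k" for i j
  proof -
    \<comment> \<open>The variable that \<open>q\<close> will miss. If it is not \<open>i\<close>, then \<open>p\<close> needs one more unit of degree for \<open>i\<close>.\<close>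
    obtain l where l: "l \<noteq> j" "expo a l > 0" "2 * expo a l + (if l = i then 0 else 1) \<le> ?k"
    proof (cases "2 * expo a i \<le> ?k")
      case False
      have "\<not> Poly_Mapping.keys a \<subseteq> {i, j}"
      proof
        assume "Poly_Mapping.keys a \<subseteq> {i, j}"
        then have "card (Poly_Mapping.keys a) \<le> card {i, j}" by (intro card_mono) simp
        also have "\<dots> \<le> 2" by (simp add: card_insert_if)
        finally show False using card by simp
      qed
      then obtain l where "l \<in> Poly_Mapping.keys a" "l \<noteq> i" "l \<noteq> j" by blast
      moreover have "expo a l + expo a i + expo a j \<le> ?k"
        using sum_expo_le_degree[of a "{l, i, j}"] calculation ij(1) by simp
      ultimately show ?thesis using False ij(3) by (intro that[of l]) (auto simp: in_keys_iff)
    qed (use that[of i] ij in auto)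
    \<comment> \<open>Any \<open>p\<close> between these bounds exhausts \<open>l\<close>, so that \<open>q = 2a - p\<close> misses it, and avoids \<open>j\<close>.\<close>
    define low where "low = Poly_Mapping.single l (2 * expo a l) + Poly_Mapping.single i (if l = i then 0 else 1)"
    define high where "high = a + a - Poly_Mapping.single j (2 * expo a j)"
    have "high + Poly_Mapping.single j (2 * expo a j) = a + a"
      by (rule poly_mapping_eqI) (auto simp: high_def lookup_add lookup_minus lookup_single when_def)
    then have "monomial_degree high + 2 * expo a j = 2 * ?k"
      by (metis monomial_degree_add monomial_degree_single mult_2)
    moreover have "monomial_degree low \<le> ?k"
      using l by (simp add: low_def monomial_degree_add)
    moreover have "expo low x \<le> expo high x" for x
      using l ij
      by (auto simp: low_def high_def lookup_add lookup_minus lookup_single when_def)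
    ultimately obtain p where p: "\<And>x. expo low x \<le> expo p x" "\<And>x. expo p x \<le> expo high x"
        "monomial_degree p = ?k"
      using monomial_between[of low high ?k] j by auto
    have le: "expo p x \<le> 2 * expo a x" for x
      using p(2)[of x] by (simp add: high_def lookup_add lookup_minus)
    have p_i: "expo p i > 0" and p_l: "expo p l = 2 * expo a l" and p_j: "expo p j = 0"
      using p(1)[of i] p(1)[of l] p(2)[of j] le[of l] ij l
      by (auto simp: low_def high_def lookup_add lookup_minus lookup_single when_def split: if_splits)
    have pq: "p + (a + a - p) = a + a"
      using le by (intro poly_mapping_eqI) (auto simp: lookup_add lookup_minus mult_2[symmetric])
    then have "monomial_degree (a + a - p) = ?k"
      using p(3) by (metis add_left_cancel monomial_degree_add)
    moreover have "Poly_Mapping.keys p \<subset> Poly_Mapping.keys a"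
      using le p_j ij(3) by (metis (no_types, lifting) in_keys_iff le_zero_eq mult_0_right
          psubsetI subsetI not_less_zero)
    moreover have "Poly_Mapping.keys (a + a - p) \<subset> Poly_Mapping.keys a"
    proof
      show "Poly_Mapping.keys (a + a - p) \<subseteq> Poly_Mapping.keys a"
        by (auto simp: in_keys_iff lookup_add lookup_minus)
      have "l \<notin> Poly_Mapping.keys (a + a - p)"
        using p_l by (simp add: in_keys_iff lookup_add lookup_minus)
      moreover have "l \<in> Poly_Mapping.keys a" using l(2) by (simp add: in_keys_iff)
      ultimately show "Poly_Mapping.keys (a + a - p) \<noteq> Poly_Mapping.keys a" by blast
    qed
    moreover have "expo (a + a - p) j > 0"
      using p_j ij(3) by (simp add: lookup_add lookup_minus)
    ultimately show ?thesis using pq p(3) p_i unfolding splits_def by blast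
  qed
  have "expo a i + expo a j \<le> ?k"
    using sum_expo_le_degree[of a "{i, j}"] ij(1) by simp
  then consider "2 * expo a j \<le> ?k" | "2 * expo a i \<le> ?k" by linarith
  then have "\<exists>p q. splits i j p q"
  proof cases
    case 1
    then show ?thesis using main ij by blast
  next
    case 2
    then obtain p q where "splits j i p q" using main[of j i] ij by auto
    then have "splits i j q p" by (auto simp: splits_def add.commute)
    then show ?thesis by blast
  qed
  then show ?thesis using that unfolding splits_def by blast
qed

section \<open>Powers of a sum of two squares\<close>

text \<open>With \<open>K + 1 = s + t\<close>, this is the Hessian form of \<open>c x\<^sub>i\<^sup>2\<^sup>s x\<^sub>j\<^sup>2\<^sup>t\<close>; \<open>U\<close> and \<open>V\<close> list the monomials
  \<open>y\<^sub>i x\<^sub>i\<^sup>a x\<^sub>j\<^sup>K\<^sup>-\<^sup>a\<close> and \<open>y\<^sub>j x\<^sub>i\<^sup>a x\<^sub>j\<^sup>K\<^sup>-\<^sup>a\<close>. The mixed term could also be split as \<open>U (s - 1) * V s\<close>, but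
  only the chosen splitting belongs to \<open>(x\<^sub>i y\<^sub>i + x\<^sub>j y\<^sub>j)\<^sup>2\<close>. In the boundary cases \<open>s = 0\<close> and
  \<open>s = K + 1\<close> the truncated differences do no harm because their coefficients vanish.\<close>

lemma hessian_form_even_two_variables:
  fixes i j :: "'v::finite"
  assumes ij: "i \<noteq> j" and s: "s \<le> Suc K"
  defines "b \<equiv> \<lambda>a. Poly_Mapping.single i a + Poly_Mapping.single j (K - a)"
  defines "U \<equiv> \<lambda>a. Mon (y_monomial i (b a))" and "V \<equiv> \<lambda>a. Mon (y_monomial j (b a))"
  shows "hessian_form (Poly_Mapping.single
        (Poly_Mapping.single i (2 * s) + Poly_Mapping.single j (2 * (Suc K - s))) c) =
      Const (c * (2 * s * (2 * s - 1))) * (U (s - 1) * U (s - 1)) +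
      Const (c * (2 * (Suc K - s) * (2 * (Suc K - s) - 1))) * (V s * V s) +
      Const (8 * c * s * (Suc K - s)) * (U s * V (s - 1))"
proof -
  let ?t = "Suc K - s"
  define m where "m = Poly_Mapping.single i (2 * s) + Poly_Mapping.single j (2 * ?t)"
  define F where "F = (\<lambda>k l. Const (c * hessian_coeff m k l) *
      (Mon (y_monomial k (m - unit_expo l - unit_expo k)) * Mon (y_monomial l 0)))"
  have F0: "F k l = 0" if "k \<notin> {i, j} \<or> l \<notin> {i, j}" for k l
    using that by (auto simp: F_def hessian_coeff_def m_def lookup_add lookup_minus lookup_single when_def)
  have "hessian_form (Poly_Mapping.single m c) = (\<Sum>k\<in>UNIV. \<Sum>l\<in>UNIV. F k l)"
    by (simp add: hessian_form_single F_def)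
  also have "\<dots> = (\<Sum>k\<in>{i, j}. \<Sum>l\<in>UNIV. F k l)"
    using F0 by (intro sum.mono_neutral_right) (auto intro: sum.neutral)
  also have "\<dots> = (\<Sum>k\<in>{i, j}. \<Sum>l\<in>{i, j}. F k l)"
    using F0 by (intro sum.cong refl sum.mono_neutral_right) auto
  also have "\<dots> = F i i + F j j + (F i j + F j i)"
    using ij by simp
  also have "F i i = Const (c * (2 * s * (2 * s - 1))) * (U (s - 1) * U (s - 1))"
  proof (cases "s = 0")
    case True
    then show ?thesis using ij
      by (simp add: F_def hessian_coeff_def m_def lookup_add lookup_single when_def)
  next
    case False
    then have "m - unit_expo i - unit_expo i = b (s - 1) + b (s - 1)"
      using ij s
      by (intro poly_mapping_eqI) (auto simp: m_def b_def lookup_add lookup_minus lookup_single when_def)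
    moreover have "hessian_coeff m i i = 2 * s * (2 * s - 1)"
      using ij by (simp add: hessian_coeff_def m_def lookup_add lookup_minus lookup_single when_def)
    ultimately show ?thesis
      by (simp only: F_def U_def y_monomial_mult)
  qed
  also have "F j j = Const (c * (2 * ?t * (2 * ?t - 1))) * (V s * V s)"
  proof (cases "?t = 0")
    case True
    then show ?thesis using ij
      by (simp add: F_def hessian_coeff_def m_def lookup_add lookup_single when_def)
  next
    case False
    then have "m - unit_expo j - unit_expo j = b s + b s"
      using ij
      by (intro poly_mapping_eqI) (auto simp: m_def b_def lookup_add lookup_minus lookup_single when_def)
    moreover have "hessian_coeff m j j = 2 * ?t * (2 * ?t - 1)"
      using ij by (simp add: hessian_coeff_def m_def lookup_add lookup_minus lookup_single when_def)
    ultimately show ?thesis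
      by (simp only: F_def V_def y_monomial_mult)
  qed
  also have "F i j + F j i = Const (8 * c * s * ?t) * (U s * V (s - 1))"
  proof (cases "s = 0 \<or> ?t = 0")
    case True
    then show ?thesis using ij
      by (auto simp: F_def hessian_coeff_def m_def lookup_add lookup_minus lookup_single when_def)
  next
    case False
    then have 1: "m - unit_expo j - unit_expo i = b s + b (s - 1)"
      "m - unit_expo i - unit_expo j = b (s - 1) + b s"
      using ij
      by (auto intro!: poly_mapping_eqI simp: m_def b_def lookup_add lookup_minus lookup_single when_def)
    have 2: "hessian_coeff m i j = 4 * s * ?t" "hessian_coeff m j i = 4 * s * ?t"
      using ij by (simp_all add: hessian_coeff_def m_def lookup_add lookup_minus lookup_single when_def)
    have "F i j = Const (c * (4 * s * ?t)) * (U s * V (s - 1))"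
      "F j i = Const (c * (4 * s * ?t)) * (V (s - 1) * U s)"
      by (simp_all only: F_def U_def V_def 1 2 y_monomial_mult)
    then have "F i j + F j i = Const (c * (4 * s * ?t) + c * (4 * s * ?t)) * (U s * V (s - 1))"
      by (simp only: distrib_right Const_add mult.commute[of "V (s - 1)"])
    then show ?thesis by (simp add: mult.assoc)
  qed
  finally show ?thesis unfolding m_def .
qed

text \<open>The product rule formula for the Hessian form of \<open>(x\<^sub>i\<^sup>2 + x\<^sub>j\<^sup>2)\<^sup>K\<^sup>+\<^sup>1\<close>, with all powers multiplied
  out by the binomial theorem. For \<open>K > 0\<close>, the weight \<open>w\<close> is \<open>4 K (K + 1)\<close> times the binomial coefficient of
  \<open>a\<close> in the \<open>(K - 1)\<close>-st power, and it vanishes for \<open>a = K\<close>.\<close>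

lemma hessian_form_two_squares_power:
  fixes i j :: "'v::finite" and K :: nat
  assumes ij: "i \<noteq> j"
  defines "b \<equiv> \<lambda>a. Poly_Mapping.single i a + Poly_Mapping.single j (K - a)"
  defines "U \<equiv> \<lambda>a. Mon (y_monomial i (b a))" and "V \<equiv> \<lambda>a. Mon (y_monomial j (b a))"
  defines "n \<equiv> real (Suc K)"
  defines "w \<equiv> \<lambda>a. 4 * n * (K choose a) * (K - a)"
  defines "m \<equiv> \<lambda>a. Poly_Mapping.single i (2 * a) + Poly_Mapping.single j (2 * (Suc K - a))"
  shows "hessian_form (\<Sum>a\<le>Suc K. Poly_Mapping.single (m a) (real (Suc K choose a))) =
      (\<Sum>a\<le>K. Const (2 * n * (K choose a)) * (U a * U a)) +
      (\<Sum>a\<le>K. Const (2 * n * (K choose a)) * (V a * V a)) +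
      (\<Sum>a\<le>K. Const (w a) * ((U (Suc a) + Const 1 * V a) * (U (Suc a) + Const 1 * V a)))"
proof -
  have binom1: "real (Suc K choose Suc a) * real (Suc a) = n * real (K choose a)" for a
    unfolding n_def by (metis Suc_times_binomial_eq mult.commute of_nat_mult)
  have binom2: "real (Suc K choose a) * real (Suc K - a) = n * real (K choose a)" if "a \<le> K" for a
    unfolding n_def using that
    by (metis binomial_absorb_comp diff_Suc_1 mult.commute of_nat_mult)
  have w_shift: "w a = 4 * n * (K choose Suc a) * Suc a" if "a \<le> K" for a
  proof -
    have "(K - a) * (K choose a) = Suc a * (K choose Suc a)"
      by (metis binomial_absorb_comp binomial_absorption)
    then show ?thesis unfolding w_def
      by (metis (no_types, opaque_lifting) mult.assoc mult.commute of_nat_mult)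
  qed

  have sumU: "(\<Sum>a\<le>Suc K. Const (real (Suc K choose a) * (2 * a * (2 * a - 1))) * (U (a - 1) * U (a - 1)))
      = (\<Sum>a\<le>K. Const (2 * n * (K choose a)) * (U a * U a)) +
        (\<Sum>a\<le>K. Const (4 * n * (K choose a) * a) * (U a * U a))"
  proof -
    have "real (Suc K choose Suc a) * (2 * Suc a * (2 * Suc a - 1))
        = 2 * n * (K choose a) + 4 * n * (K choose a) * a" for a
    proof -
      have "real (Suc K choose Suc a) * (2 * Suc a * (2 * Suc a - 1))
          = 2 * (real (Suc K choose Suc a) * Suc a) * (2 * a + 1)"
        by (simp add: algebra_simps del: binomial_Suc_Suc)
      then show ?thesis unfolding binom1 by (simp add: algebra_simps)
    qed
    then show ?thesis
      by (simp only: sum.atMost_Suc_shift Const_add distrib_right sum.distrib diff_Suc_1) simp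
  qed
  have sumV: "(\<Sum>a\<le>Suc K. Const (real (Suc K choose a) * (2 * (Suc K - a) * (2 * (Suc K - a) - 1))) * (V a * V a))
      = (\<Sum>a\<le>K. Const (2 * n * (K choose a)) * (V a * V a)) + (\<Sum>a\<le>K. Const (w a) * (V a * V a))"
  proof -
    have "real (Suc K choose a) * (2 * (Suc K - a) * (2 * (Suc K - a) - 1)) = 2 * n * (K choose a) + w a"
      if "a \<le> K" for a
    proof -
      from le_Suc_ex[OF that] obtain e where e: "K = a + e" ..
      have "real (Suc K choose a) * (2 * (Suc K - a) * (2 * (Suc K - a) - 1))
          = 2 * (real (Suc K choose a) * real (Suc K - a)) * (2 * real (K - a) + 1)"
        by (simp add: e algebra_simps del: binomial_Suc_Suc)
      also have "\<dots> = 2 * n * (K choose a) + w a"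
        unfolding binom2[OF that] w_def by (simp only: distrib_left mult_ac mult_1_right)
      finally show ?thesis .
    qed
    then show ?thesis
      by (simp add: sum.distrib[symmetric] distrib_right[symmetric] Const_add[symmetric] del: binomial_Suc_Suc)
  qed
  have sumUV: "(\<Sum>a\<le>Suc K. Const (8 * real (Suc K choose a) * a * (Suc K - a)) * (U a * V (a - 1)))
      = (\<Sum>a\<le>K. Const (2 * w a) * (U (Suc a) * V a))"
  proof -
    have "8 * real (Suc K choose Suc a) * Suc a * (Suc K - Suc a) = 2 * w a" for a
    proof -
      have "8 * real (Suc K choose Suc a) * Suc a * (Suc K - Suc a)
          = 8 * (real (Suc K choose Suc a) * Suc a) * (K - a)"
        by (simp add: algebra_simps del: binomial_Suc_Suc)
      then show ?thesis unfolding binom1 w_def by simp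
    qed
    then show ?thesis
      by (simp only: sum.atMost_Suc_shift diff_Suc_1) simp
  qed
  \<comment> \<open>This balances the two squares: the excess of the diagonal at \<open>U (a + 1)\<close> equals the one at \<open>V a\<close>.\<close>
  have shiftU: "(\<Sum>a\<le>K. Const (4 * n * (K choose a) * a) * (U a * U a))
      = (\<Sum>a\<le>K. Const (w a) * (U (Suc a) * U (Suc a)))"
  proof -
    have "(\<Sum>a\<le>K. Const (4 * n * (K choose a) * a) * (U a * U a))
        = (\<Sum>a\<le>Suc K. Const (4 * n * (K choose a) * a) * (U a * U a))"
      by (simp add: binomial_eq_0)
    also have "\<dots> = (\<Sum>a\<le>K. Const (4 * n * (K choose Suc a) * Suc a) * (U (Suc a) * U (Suc a)))"
      by (simp only: sum.atMost_Suc_shift) simp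
    finally show ?thesis using w_shift by simp
  qed
  have binomial_squares: "(\<Sum>a\<le>K. Const (w a) * ((U (Suc a) + Const 1 * V a) * (U (Suc a) + Const 1 * V a)))
      = (\<Sum>a\<le>K. Const (w a) * (U (Suc a) * U (Suc a))) + (\<Sum>a\<le>K. Const (w a) * (V a * V a)) +
        (\<Sum>a\<le>K. Const (2 * w a) * (U (Suc a) * V a))"
  proof -
    have "Const c * ((u + Const 1 * v) * (u + Const 1 * v))
        = Const c * (u * u) + Const c * (v * v) + Const (2 * c) * (u * v)"
      for c and u v :: "('v + 'v) real_poly"
      by (simp only: Const_1 mult_1 mult_2 Const_add) (simp only: distrib_left distrib_right ac_simps)
    then show ?thesis by (simp only: sum.distrib)
  qed
  have "hessian_form (\<Sum>a\<le>Suc K. Poly_Mapping.single (m a) (real (Suc K choose a)))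
      = (\<Sum>a\<le>Suc K. hessian_form (Poly_Mapping.single (m a) (real (Suc K choose a))))"
    by (rule hessian_form_sum)
  also have "\<dots> = (\<Sum>a\<le>Suc K.
      Const (real (Suc K choose a) * (2 * a * (2 * a - 1))) * (U (a - 1) * U (a - 1)) +
      Const (real (Suc K choose a) * (2 * (Suc K - a) * (2 * (Suc K - a) - 1))) * (V a * V a) +
      Const (8 * real (Suc K choose a) * a * (Suc K - a)) * (U a * V (a - 1)))"
    unfolding m_def U_def V_def b_def
    by (intro sum.cong refl hessian_form_even_two_variables ij) simp
  also have "\<dots> = (\<Sum>a\<le>K. Const (2 * n * (K choose a)) * (U a * U a)) +
      (\<Sum>a\<le>K. Const (2 * n * (K choose a)) * (V a * V a)) +
      (\<Sum>a\<le>K. Const (w a) * ((U (Suc a) + Const 1 * V a) * (U (Suc a) + Const 1 * V a)))"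
    unfolding sum.distrib sumU sumV sumUV shiftU binomial_squares by (simp only: add_ac)
  finally show ?thesis .
qed

text \<open>In the Hessian form of \<open>(x\<^sub>i\<^sup>2 + x\<^sub>j\<^sup>2)\<^sup>s\<^sup>+\<^sup>t\<^sup>+\<^sup>1\<close> everything is dsos, and the wanted square occurs in
  it with a positive coefficient.\<close>

lemma square_bounded_pair:
  fixes i j :: "'v::finite"
  assumes ij: "i \<noteq> j" and deg: "s + t < d"
  shows "square_bounded d i (Poly_Mapping.single i s + Poly_Mapping.single j t)"
proof -
  define K where "K = s + t"
  define n where "n = real (Suc K)"
  define b where "b = (\<lambda>a. Poly_Mapping.single i a + Poly_Mapping.single j (K - a))"
  define U where "U = (\<lambda>a. Mon (y_monomial i (b a)))"
  define V where "V = (\<lambda>a. Mon (y_monomial j (b a)))"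
  define m where "m = (\<lambda>s. Poly_Mapping.single i (2 * s) + Poly_Mapping.single j (2 * (Suc K - s)))"
  define g where "g = (\<Sum>s\<le>Suc K. Poly_Mapping.single (m s) (real (Suc K choose s)))"
  define w where "w = (\<lambda>a. 4 * n * (K choose a) * (K - a))"
  define rest where "rest =
      (\<Sum>a\<in>{..K} - {s}. Const (2 * n * (K choose a)) * (U a * U a)) +
      (\<Sum>a\<le>K. Const (2 * n * (K choose a)) * (V a * V a)) +
      (\<Sum>a\<le>K. Const (w a) * ((U (Suc a) + Const 1 * V a) * (U (Suc a) + Const 1 * V a)))"
  have s: "s \<in> {..K}" by (simp add: K_def)
  have "hessian_form g = (\<Sum>a\<le>K. Const (2 * n * (K choose a)) * (U a * U a)) +
      (\<Sum>a\<le>K. Const (2 * n * (K choose a)) * (V a * V a)) +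
      (\<Sum>a\<le>K. Const (w a) * ((U (Suc a) + Const 1 * V a) * (U (Suc a) + Const 1 * V a)))"
    unfolding g_def m_def U_def V_def b_def n_def w_def
    by (rule hessian_form_two_squares_power[OF ij])
  also have "\<dots> = Const (2 * n * (K choose s)) * (U s * U s) + rest"
    unfolding rest_def using s by (simp add: sum.remove[OF _ s] add.assoc)
  \<comment> \<open>The trailing zero is the error term of \<open>hessian_bounded_summand\<close>.\<close>
  finally have hess_g: "hessian_form g = Const (2 * n * (K choose s)) * (U s * U s) + rest + 0"
    by simp

  have deg_b: "monomial_degree (b a) < d" if "a \<le> K" for a
    using that deg by (simp add: b_def K_def monomial_degree_add)
  have n: "n > 0" by (simp add: n_def)
  have w_nonneg: "w a \<ge> 0" for a
    using n by (simp add: w_def)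
  have "dsos d (Const (w a) * ((U (Suc a) + Const 1 * V a) * (U (Suc a) + Const 1 * V a)))"
    if "a \<le> K" for a
  proof (cases "a = K")
    case True
    \<comment> \<open>Here \<open>U (Suc K)\<close> may have too large a degree for a Gram monomial, but its weight is zero.\<close>
    then show ?thesis by (simp add: w_def dsos_0)
  next
    case False
    with that show ?thesis
      unfolding U_def V_def
      by (intro dsos_scale[OF dsos_binomial_square w_nonneg] y_monomial_upto deg_b) auto
  qed
  then have "dsos d rest"
    unfolding rest_def U_def V_def using n
    by (intro dsos_add dsos_sum) (auto intro!: dsos_scale dsos_square y_monomial_upto deg_b)
  moreover have "dsos d (Const (2 * n * (K choose s)) * (U s * U s))"
    unfolding U_def using n s by (intro dsos_scale dsos_square y_monomial_upto deg_b) auto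
  moreover have "g \<in> polys_upto (2 * d)"
    unfolding g_def using deg
    by (intro polys_upto_sum polys_upto_single) (auto simp: m_def monomial_degree_add K_def)
  ultimately have "hessian_bounded d (Const (2 * n * (K choose s)) * (U s * U s))"
    using hess_g hessian_bounded_0 by (blast intro: hessian_bounded_summand)
  then have "square_bounded d i (b s)"
    unfolding U_def using n s
    by (intro square_boundedI[OF deg_b, of s "2 * n * (K choose s)"]) (simp_all add: zero_less_binomial)
  then show ?thesis by (simp add: b_def K_def)
qed

section \<open>Every Hessian form is controlled\<close>

text \<open>Induction on the number of variables of \<open>x\<^sub>i x\<^sup>b\<close>. Two variables need the explicit polynomial of
  \<open>square_bounded_pair\<close>. Otherwise \<open>x\<^sup>2\<^sup>a\<close> with \<open>x\<^sup>a = x\<^sub>i x\<^sup>b\<close> works: it has either no mixed terms or at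
  least three variables, and then each mixed term splits into factors with fewer variables.\<close>

lemma square_bounded_all:
  fixes b :: "'v::finite monomial"
  assumes "monomial_degree b < d"
  shows "square_bounded d i b"
  using assms
proof (induction "card (Poly_Mapping.keys (b + unit_expo i))" arbitrary: i b rule: less_induct)
  case less
  define a where "a = b + unit_expo i"
  have b: "b = a - unit_expo i" by (simp add: a_def)
  have pos: "expo a i > 0" by (simp add: a_def lookup_add)
  have deg: "monomial_degree a \<le> d" using less.prems by (simp add: a_def monomial_degree_add)
  show ?case
  proof (cases "card (Poly_Mapping.keys a) = 2")
    case True
    have i: "i \<in> Poly_Mapping.keys a" using pos by (simp add: in_keys_iff)
    with True have "card (Poly_Mapping.keys a - {i}) = 1" by simp
    then obtain j where "Poly_Mapping.keys a - {i} = {j}" by (rule card_1_singletonE)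
    with i have j: "j \<noteq> i" "Poly_Mapping.keys a = {i, j}" by auto
    have "expo b x = 0" if "x \<noteq> i" "x \<noteq> j" for x
    proof -
      have "x \<notin> Poly_Mapping.keys a" using that j(2) by simp
      then have "expo a x = 0" by (simp only: in_keys_iff not_not)
      then show ?thesis unfolding b lookup_minus by simp
    qed
    with j(1) have b_eq: "Poly_Mapping.single i (expo b i) + Poly_Mapping.single j (expo b j) = b"
      by (intro poly_mapping_eqI) (auto simp: lookup_add lookup_single when_def)
    have "expo b i + expo b j < d"
      using arg_cong[OF b_eq, of monomial_degree] less.prems by (simp add: monomial_degree_add)
    from square_bounded_pair[OF j(1)[symmetric] this] show ?thesis
      unfolding b_eq .
  next
    case False
    show ?thesis
      unfolding b
    proof (rule square_bounded_even[OF deg pos])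
      fix k l
      assume kl: "k \<noteq> l" "expo a k > 0" "expo a l > 0"
      then have "card {k, l} \<le> card (Poly_Mapping.keys a)"
        by (intro card_mono) (auto simp: in_keys_iff)
      with False kl(1) have "card (Poly_Mapping.keys a) \<ge> 3" by simp
      then obtain p q where pq: "p + q = a + a" "expo p k > 0" "expo q l > 0"
        and p: "monomial_degree p = monomial_degree a" "Poly_Mapping.keys p \<subset> Poly_Mapping.keys a"
        and q: "monomial_degree q = monomial_degree a" "Poly_Mapping.keys q \<subset> Poly_Mapping.keys a"
        using split_even_monomial[OF kl] by metis
      have good: "square_bounded d k (p - unit_expo k)"
        if "expo p k > 0" "monomial_degree p = monomial_degree a"
          "Poly_Mapping.keys p \<subset> Poly_Mapping.keys a" for p k
      proof (rule less.hyps)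
        note eq = minus_unit_expo_add[OF that(1)]
        show "card (Poly_Mapping.keys (p - unit_expo k + unit_expo k))
            < card (Poly_Mapping.keys (b + unit_expo i))"
          unfolding eq a_def[symmetric] by (rule psubset_card_mono) (simp_all add: that)
        show "monomial_degree (p - unit_expo k) < d"
          using arg_cong[OF eq, of monomial_degree] deg that(2) by (simp add: monomial_degree_add)
      qed
      have "a + a = (p - unit_expo k + unit_expo k) + (q - unit_expo l + unit_expo l)"
        unfolding minus_unit_expo_add[OF pq(2)] minus_unit_expo_add[OF pq(3)] using pq(1) by simp
      then have "a + a = (p - unit_expo k) + (q - unit_expo l) + unit_expo k + unit_expo l"
        by (simp only: add_ac)
      then show "\<exists>b b'. a + a = b + b' + unit_expo k + unit_expo l \<and> square_bounded d k b \<and> square_bounded d l b'"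
        using good[OF pq(2) p] good[OF pq(3) q] by blast
    qed
  qed
qed

text \<open>Every nonzero term \<open>y\<^sub>i y\<^sub>j x\<^sup>c\<close> has \<open>c\<close> of degree at most \<open>2 (d - 1)\<close>, so \<open>c\<close> is a sum of two exponents of
  degree at most \<open>d - 1\<close>, and all squares of such Gram monomials are bounded.\<close>

lemma hessian_bounded_hessian_form:
  fixes p :: "'v::finite real_poly"
  assumes "d \<ge> 1" "p \<in> polys_upto (2 * d)"
  shows "hessian_bounded d (hessian_form p)"
proof -
  have "hessian_bounded d (Const (c * hessian_coeff m i j) *
      (Mon (y_monomial i (m - unit_expo j - unit_expo i)) * Mon (y_monomial j 0)))"
    if m: "monomial_degree m \<le> 2 * d" for m :: "'v monomial" and c i j
  proof (cases "hessian_coeff m i j = 0")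
    case True
    then show ?thesis by (simp add: hessian_bounded_0)
  next
    case False
    then have "expo m j > 0" "expo (m - unit_expo j) i > 0"
      by (auto simp: hessian_coeff_def)
    then have "monomial_degree m = Suc (Suc (monomial_degree (m - unit_expo j - unit_expo i)))"
      by (metis minus_unit_expo_add monomial_degree_add monomial_degree_single Suc_eq_plus1)
    then have le: "monomial_degree (m - unit_expo j - unit_expo i) \<le> 2 * (d - 1)"
      (is "monomial_degree ?r \<le> _")
      using m by simp
    obtain u where u: "\<And>x. expo u x \<le> expo ?r x" "monomial_degree u = min (d - 1) (monomial_degree ?r)"
      using monomial_between[of 0 ?r "min (d - 1) (monomial_degree ?r)"]
      by (auto simp: monomial_degree_def[of 0])
    have r: "u + (?r - u) = ?r"
    proof (rule poly_mapping_eqI)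
      show "expo (u + (?r - u)) x = expo ?r x" for x
        unfolding lookup_add lookup_minus[of ?r u] using u(1) by (rule le_add_diff_inverse)
    qed
    then have "monomial_degree u + monomial_degree (?r - u) = monomial_degree ?r"
      by (metis monomial_degree_add)
    then have "monomial_degree u < d" "monomial_degree (?r - u) < d"
      using u(2) le assms(1) by auto
    then have "hessian_bounded d (Mon (y_monomial i (u + (?r - u))) * Mon (y_monomial j 0))"
      by (intro hessian_bounded_mixed square_bounded_all)
    then show ?thesis unfolding r by (rule hessian_bounded_scale)
  qed
  then have "hessian_bounded d (hessian_form (Poly_Mapping.single m c))"
    if "monomial_degree m \<le> 2 * d" for m :: "'v monomial" and c
    unfolding hessian_form_single using that by (intro hessian_bounded_sum)
  then have "hessian_bounded d (\<Sum>m\<in>Poly_Mapping.keys p. hessian_form (Poly_Mapping.single m (Poly_Mapping.lookup p m)))"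
    using assms(2) by (intro hessian_bounded_sum) (simp add: polys_upto_def)
  then show ?thesis
    unfolding hessian_form_sum[symmetric] poly_as_sum[symmetric] .
qed

theorem theorem5p3p5:
  fixes p :: "'n::finite real_poly" and d :: nat
  assumes "d \<ge> 1"
    and "p \<in> polys_upto (2 * d)"
  shows "\<exists>g h. g \<in> polys_upto (2 * d) \<and> h \<in> polys_upto (2 * d) \<and>
           dsos_convex d g \<and> dsos_convex d h \<and> p = g - h"
proof -
  obtain f where f: "f \<in> polys_upto (2 * d)"
    and bounds: "dsos d (hessian_form f + hessian_form p)" "dsos d (hessian_form f - hessian_form p)"
    using hessian_bounded_hessian_form[OF assms] unfolding hessian_bounded_def by blast
  define g where "g = Const (1 / 2) * (f + p)"
  define h where "h = Const (1 / 2) * (f + Const (- 1) * p)"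
  have "g \<in> polys_upto (2 * d)" "h \<in> polys_upto (2 * d)"
    unfolding g_def h_def by (intro polys_upto_scale polys_upto_add f assms(2))+
  moreover have "dsos_convex d g" "dsos_convex d h"
    unfolding dsos_convex_def g_def h_def hessian_form_scale hessian_form_add
    using bounds by (auto intro!: dsos_scale simp: Const_uminus)
  moreover have "g - h = p"
  proof -
    have "g - h = Const (1 / 2) * (p + p)"
      by (simp add: g_def h_def Const_uminus algebra_simps)
    also have "\<dots> = Const (1 / 2 + 1 / 2) * p"
      by (simp only: Const_add distrib_left distrib_right)
    finally show ?thesis by simp
  qed
  ultimately show ?thesis by blast
qed

end
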